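(* Let $\mathcal H$ be a real Hilbert space and let $f:\mathcal H\to\mathbb R$ be a convex differentiable function with $\operatorname{argmin}_{\mathcal H} f\neq\emptyset$. Let $\mu\ge 0$, $0\le q\le 1$, $\alpha>0$ and $t_0>0$. Let $x:[t_0,+\infty[\to\mathcal H$ be a solution trajectory of $$\ddot x(t)+\frac{\alpha}{t^{1-q}}\dot x(t)+e^{\mu t^q}\nabla f(x(t))=0 .$$ Suppose that $\alpha\le\mu q$. Then, as $t\to+\infty$, $$f(x(t))-\min_{\mathcal H} f=\mathcal O\left(e^{-\frac{2\alpha+\mu q}{3}t^q}\right).$$
   Context: A solution trajectory is a $C^2$ function $x:[t_0,+\infty[\to\mathcal H$ satisfying the differential equation for all $t\ge t_0$ (existence is taken for granted). *)

theory Defs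
  imports "HOL-Analysis.Analysis" "HOL-Library.Landau_Symbols"
begin

text \<open>
  By the Riesz representation theorem, this is well defined at every point where \<open>f\<close> is
  Frechet differentiable, provided the inner product space is complete.
\<close>

definition gradient :: "('a::real_inner \<Rightarrow> real) \<Rightarrow> 'a \<Rightarrow> 'a" where
  "gradient f x = (THE D. GDERIV f x :> D)"

lemma gradient_eqI:
  assumes "GDERIV f x :> D"
  shows "gradient f x = D"
  unfolding gradient_def
proof (rule the_equality)
  show "GDERIV f x :> D" by (fact assms)
next
  fix E assume "GDERIV f x :> E"
  with assms have "(\<lambda>h. inner h E) = (\<lambda>h. inner h D)"
    unfolding gderiv_def by (blast intro: has_derivative_unique)
  then have "inner (E - D) E = inner (E - D) D" by (rule fun_cong)
  then have "inner (E - D) (E - D) = 0" by (simp add: inner_diff_right)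
  then show "E = D" by simp
qed

text \<open>
  Derivatives are taken within \<open>{t0..}\<close>, hence are one-sided at \<open>t0\<close>; the values of \<open>x\<close>
  to the left of \<open>t0\<close> are irrelevant.
\<close>

definition solution_trajectory ::
  "real \<Rightarrow> real \<Rightarrow> real \<Rightarrow> real \<Rightarrow> ('a::real_inner \<Rightarrow> real) \<Rightarrow> (real \<Rightarrow> 'a) \<Rightarrow> bool" where
  "solution_trajectory \<alpha> \<mu> q t0 f x \<longleftrightarrow>
    (\<exists>x' x''.
      (\<forall>t\<ge>t0. (x has_vector_derivative x' t) (at t within {t0..})) \<and>
      (\<forall>t\<ge>t0. (x' has_vector_derivative x'' t) (at t within {t0..})) \<and>
      continuous_on {t0..} x'' \<and>
      (\<forall>t\<ge>t0. x'' t + (\<alpha> / t powr (1 - q)) *\<^sub>R x' t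
                + exp (\<mu> * t powr q) *\<^sub>R gradient f (x t) = 0))"

end

theory Submission
  imports Defs
begin

text \<open>
  The hypotheses \<open>\<alpha> > 0\<close> and \<open>\<alpha> \<le> \<mu> * q\<close> force \<open>q > 0\<close>, so the time scale
  \<open>\<Theta> t = t powr q / q\<close> is available, with rate \<open>\<sigma> t = t powr (q - 1)\<close>. On this scale
  the damping is \<open>\<alpha> * \<sigma>\<close> and the factor of the gradient is \<open>exp (b * \<Theta>)\<close> with
  \<open>b = \<mu> * q\<close>. Put \<open>k = (2 * \<alpha> + b) / 3\<close> and \<open>\<rho> = (b - \<alpha>) / 3\<close>, so that
  \<open>\<alpha> = k - \<rho>\<close> and \<open>b = k + 2 * \<rho>\<close>; the hypothesis \<open>\<alpha> \<le> b\<close> says \<open>\<rho> \<ge> 0\<close>.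

  For a minimiser \<open>z\<close> and \<open>y = x - z\<close> consider the energy
  \<open>exp (k * \<Theta>) * (f x - f z) +
   exp (- 2 * \<rho> * \<Theta>) * (\<bar>k * \<sigma> * y + x'\<bar>\<^sup>2 + k * (\<rho> * \<sigma>\<^sup>2 - \<sigma>') * \<bar>y\<bar>\<^sup>2) / 2\<close>,
  where bars denote norms. It is a sum of nonnegative terms. The parameters are determined by
  cancellations in its derivative: the ratio of the two exponentials is the factor of the
  gradient, which removes the product of the gradient with the velocity; the choice
  \<open>k = \<alpha> + \<rho>\<close> removes the square of the velocity; and the coefficient of
  \<open>\<bar>y\<bar>\<^sup>2\<close> is the one that removes the product of \<open>y\<close> and the velocity. What remains is
  \<open>f x - f z\<close> minus the product of \<open>y\<close> and the gradient, which convexity makes nonpositive,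
  and a multiple of \<open>\<bar>y\<bar>\<^sup>2\<close>, which is nonpositive because \<open>\<sigma>\<close> is nonnegative,
  decreasing and convex (\<open>energy_derivative_nonpos\<close>). So the energy is bounded by its initial
  value, and \<open>f x - f z\<close> is of order \<open>exp (- k * \<Theta>)\<close>
  (\<open>value_decay_of_damped_trajectory\<close>). Since \<open>\<Theta> t \<ge> t powr q\<close> for \<open>q \<le> 1\<close>, this
  is at least the claimed rate.

  The gradient is defined as a vector that represents the derivative; that one exists is the
  Riesz representation theorem.
\<close>

section \<open>Gradients of convex functions on a Hilbert space\<close>

text \<open>
  The representing vector is the minimiser of \<open>J u = (norm u)\<^sup>2 / 2 - L u\<close>, whose gradient at
  \<open>D\<close> is \<open>D\<close> minus the vector sought. The parallelogram law makes every minimising sequence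
  a Cauchy sequence, so completeness supplies the minimiser even in infinite dimension.
\<close>

theorem riesz_representation:
  fixes L :: "'a::{real_inner, complete_space} \<Rightarrow> real"
  assumes "bounded_linear L"
  shows "\<exists>D. \<forall>h. L h = inner h D"
proof -
  interpret L: bounded_linear L by fact
  define J where "J u = (norm u)\<^sup>2 / 2 - L u" for u
  define m where "m = Inf (range J)"
  obtain K where K: "\<And>u. norm (L u) \<le> norm u * K"
    using L.bounded by blast
  have "J u \<ge> - (K\<^sup>2 / 2)" for u
  proof -
    have "L u \<le> norm u * K" using K[of u] by simp
    moreover have "0 \<le> (norm u - K)\<^sup>2" by simp
    ultimately show ?thesis unfolding J_def by (simp add: power2_diff)
  qed
  then have bdd: "bdd_below (range J)" by (intro bdd_belowI2)
  then have m_le: "m \<le> J u" for u unfolding m_def by (simp add: cInf_lower)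
  have "\<exists>u. J u < m + 1 / real (Suc n)" for n
    using cInf_less_iff[of "range J" "m + 1 / real (Suc n)"] bdd by (auto simp: m_def)
  then obtain u where u: "\<And>n. J (u n) < m + 1 / real (Suc n)" by metis
  define mid where "mid v w = (1/2) *\<^sub>R (v + w)" for v w :: 'a
  have parallelogram: "(norm (v - w))\<^sup>2 = 4 * (J v + J w - 2 * J (mid v w))" for v w
    unfolding J_def mid_def L.scaleR L.add power2_norm_eq_inner
    by (simp add: inner_add_left inner_add_right inner_diff_left inner_diff_right inner_commute
        field_simps)
  have near: "(norm (v - w))\<^sup>2 \<le> 4 * a + 4 * b" if "J v < m + a" "J w < m + b" for v w a b
    using that m_le[of "mid v w"] unfolding parallelogram by (simp add: algebra_simps)
  have "Cauchy u"
  proof (rule metric_CauchyI)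
    fix e :: real assume e: "0 < e"
    obtain N :: nat where N: "inverse (real (Suc N)) < e\<^sup>2 / 8"
      using reals_Archimedean[of "e\<^sup>2 / 8"] e by auto
    show "\<exists>M. \<forall>i\<ge>M. \<forall>j\<ge>M. dist (u i) (u j) < e"
    proof (intro exI allI impI)
      fix i j assume "N \<le> i" "N \<le> j"
      then have "1 / real (Suc i) \<le> inverse (real (Suc N))"
        "1 / real (Suc j) \<le> inverse (real (Suc N))"
        by (simp_all add: field_simps)
      with near[OF u u, of i j] N have "(norm (u i - u j))\<^sup>2 < e\<^sup>2" by linarith
      then show "dist (u i) (u j) < e" using e
        by (simp add: dist_norm power_less_imp_less_base)
    qed
  qed
  then obtain D where D: "u \<longlonglongrightarrow> D" using Cauchy_convergent convergent_def by blast
  have "(\<lambda>n. J (u n)) \<longlonglongrightarrow> J D"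
    unfolding J_def by (intro tendsto_intros L.tendsto D) simp
  moreover have "(\<lambda>n. m + 1 / real (Suc n)) \<longlonglongrightarrow> m + 0"
    by (intro tendsto_add tendsto_const LIMSEQ_Suc[OF lim_1_over_n])
  ultimately have "J D \<le> m + 0"
    by (rule LIMSEQ_le) (use u less_imp_le in blast)
  then have min: "J D \<le> J w" for w using m_le[of w] by simp
  have "L h = inner h D" for h
  proof (cases "h = 0")
    case False
    define s where "s = inner h D - L h"
    \<comment> \<open>The step length that minimises \<open>J\<close> on the line through \<open>D\<close> in direction \<open>h\<close>.\<close>
    define r where "r = s / inner h h"
    have h: "inner h h > 0" using False by simp
    have "J (D - r *\<^sub>R h) = J D - r * s + r\<^sup>2 * inner h h / 2"
      unfolding J_def s_def L.diff L.scaleR power2_norm_eq_inner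
      by (simp add: inner_diff_left inner_diff_right inner_commute power2_eq_square field_simps)
    also have "\<dots> = J D - s\<^sup>2 / (2 * inner h h)"
      using h by (simp add: r_def power2_eq_square field_simps)
    finally have "s\<^sup>2 / (2 * inner h h) \<le> 0" using min[of "D - r *\<^sub>R h"] by linarith
    then have "s\<^sup>2 \<le> 0" using h by (simp add: divide_le_0_iff)
    then show ?thesis by (simp add: s_def)
  qed (simp add: L.zero)
  then show ?thesis by blast
qed

lemma GDERIV_gradient:
  fixes f :: "'a::{real_inner, complete_space} \<Rightarrow> real"
  assumes "f differentiable (at y)"
  shows "GDERIV f y :> gradient f y"
proof -
  obtain L where L: "(f has_derivative L) (at y)"
    using assms unfolding differentiable_def by blast
  obtain D where "\<forall>h. L h = inner h D"
    using riesz_representation[OF has_derivative_bounded_linear[OF L]] by blast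
  then have "GDERIV f y :> D" using L unfolding gderiv_def by presburger
  then show ?thesis using gradient_eqI by metis
qed

lemma GDERIV_chain_within:
  assumes "GDERIV f (x t) :> D" and "(x has_vector_derivative v) (at t within S)"
  shows "((\<lambda>t. f (x t)) has_real_derivative inner v D) (at t within S)"
proof -
  have "(f has_derivative (\<lambda>h. inner h D)) (at (x t) within x ` S)"
    using assms(1) unfolding gderiv_def by (rule has_derivative_at_withinI)
  from vector_derivative_diff_chain_within[OF assms(2) this] show ?thesis
    by (simp add: has_real_derivative_iff_has_vector_derivative o_def)
qed

text \<open>The one-dimensional tangent inequality, applied along the segment from \<open>y\<close> to \<open>z\<close>.\<close>

lemma convex_on_imp_above_tangent_plane:
  assumes "convex_on UNIV f" and "GDERIV f y :> D"
  shows "f y + inner (z - y) D \<le> f z"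
proof -
  define p where "p s = y + s *\<^sub>R (z - y)" for s :: real
  have "convex_on UNIV (\<lambda>s. f (p s))"
  proof (rule convex_onI)
    fix t r s :: real
    assume t: "0 < t" "t < 1"
    have "p ((1 - t) *\<^sub>R r + t *\<^sub>R s) = (1 - t) *\<^sub>R p r + t *\<^sub>R p s"
      by (simp add: p_def algebra_simps)
    then show "f (p ((1 - t) *\<^sub>R r + t *\<^sub>R s)) \<le> (1 - t) * f (p r) + t * f (p s)"
      using convex_onD[OF assms(1), of t "p r" "p s"] t by simp
  qed simp
  moreover have "((\<lambda>s. f (p s)) has_real_derivative inner (z - y) D) (at 0)"
  proof (rule GDERIV_chain_within[where x = p])
    show "GDERIV f (p 0) :> D" using assms(2) by (simp add: p_def)
    show "(p has_vector_derivative z - y) (at 0)"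
      unfolding p_def by (auto intro!: derivative_eq_intros)
  qed
  ultimately have "f (p 1) - f (p 0) \<ge> inner (z - y) D * (1 - 0)"
    by (intro convex_on_imp_above_tangent[where A = UNIV]) auto
  then show ?thesis by (simp add: p_def)
qed

section \<open>The Lyapunov function\<close>

lemma nonincreasing_of_derivative_nonpos_on_ray:
  fixes E :: "real \<Rightarrow> real"
  assumes deriv: "\<And>t. t \<ge> t0 \<Longrightarrow> (E has_real_derivative E' t) (at t within {t0..})"
    and nonpos: "\<And>t. t \<ge> t0 \<Longrightarrow> E' t \<le> 0"
    and "t0 \<le> t"
  shows "E t \<le> E t0"
proof (rule DERIV_nonpos_imp_decreasing_open[where f = E])
  show "\<exists>y. (E has_real_derivative y) (at s) \<and> y \<le> 0" if "t0 < s" "s < t" for s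
    using deriv[of s] nonpos[of s] that at_within_interior[of s "{t0..}"] by auto
  show "continuous_on {t0..t} E"
    using DERIV_continuous_on[of "{t0..}" E E'] deriv continuous_on_subset[of "{t0..}" E "{t0..t}"]
    by auto
qed fact

text \<open>
  This is the algebra behind the Lyapunov function at one fixed time: \<open>y\<close>, \<open>v\<close> and \<open>g\<close>
  stand for the displacement \<open>x - z\<close>, velocity and gradient, \<open>W\<close> for the gap
  \<open>f x - f z\<close>, \<open>A\<close> and \<open>C\<close> for the exponential weights with logarithmic derivatives
  \<open>k * \<sigma>\<close> and \<open>- 2 * \<rho> * \<sigma>\<close>, and \<open>\<beta>\<close> for the factor of the gradient. The vector
  \<open>p'\<close> is the derivative of \<open>p\<close> after the acceleration has been eliminated by the
  differential equation, so the left-hand side is the derivative of the energy.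
\<close>

lemma energy_derivative_nonpos:
  fixes y v g :: "'a::real_inner" and A C \<beta> k \<rho> \<sigma> \<sigma>' \<sigma>'' W :: real
  defines "D \<equiv> k * (\<rho> * \<sigma>\<^sup>2 - \<sigma>')" and "D' \<equiv> k * (2 * \<rho> * \<sigma> * \<sigma>' - \<sigma>'')"
    and "p \<equiv> (k * \<sigma>) *\<^sub>R y + v"
    and "p' \<equiv> (k * \<sigma>') *\<^sub>R y + (k * \<sigma>) *\<^sub>R v - ((k - \<rho>) * \<sigma>) *\<^sub>R v - \<beta> *\<^sub>R g"
  assumes pos: "k \<ge> 0" "\<rho> \<ge> 0" "\<sigma> \<ge> 0" "\<sigma>' \<le> 0" "\<sigma>'' \<ge> 0" "C \<ge> 0" "A \<ge> 0"
    and A: "A = C * \<beta>"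
    and W: "W \<le> inner y g"
  shows "(k * \<sigma> * A) * W + A * inner v g
    + ((- 2 * \<rho> * \<sigma> * C) * (inner p p / 2 + D * inner y y / 2)
       + C * (inner p p' + (D' * inner y y / 2 + D * inner y v))) \<le> 0"
    (is "?E \<le> 0")
proof -
  \<comment> \<open>All terms with \<open>inner y v\<close>, \<open>inner v v\<close> and \<open>inner v g\<close> cancel here.\<close>
  have "?E = k * \<sigma> * A * (W - inner y g)
      + C * (- ((\<rho> + k) * \<sigma> * D) + D' / 2) * inner y y"
    unfolding D_def D'_def p_def p'_def A
    by (simp add: inner_add_left inner_add_right inner_diff_right inner_diff_left
        inner_commute[of v y] inner_commute[of g] power2_eq_square field_simps)
  moreover have "k * \<sigma> * A * (W - inner y g) \<le> 0"
    using pos W by (intro mult_nonneg_nonpos) auto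
  moreover have "D \<ge> 0"
    unfolding D_def using pos by (intro mult_nonneg_nonneg) (auto intro: order_trans[of _ 0])
  then have "(\<rho> + k) * \<sigma> * D \<ge> 0" using pos by simp
  moreover have "\<rho> * \<sigma> * \<sigma>' \<le> 0" using pos by (intro mult_nonneg_nonpos) auto
  then have "D' \<le> 0"
    unfolding D'_def using pos by (intro mult_nonneg_nonpos) auto
  then have "C * (- ((\<rho> + k) * \<sigma> * D) + D' / 2) * inner y y \<le> 0"
    using pos \<open>(\<rho> + k) * \<sigma> * D \<ge> 0\<close> by (intro mult_nonpos_nonneg mult_nonneg_nonpos) auto
  ultimately show ?thesis by linarith
qed

text \<open>
  Of the powers of \<open>t\<close> in the differential equation, the Lyapunov argument uses only the signs
  of \<open>\<sigma>\<close> and its first two derivatives, so the decay estimate is stated for an arbitrary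
  time scale \<open>\<Theta>\<close> whose rate \<open>\<sigma>\<close> is nonnegative, decreasing and convex. The constant is
  the initial energy.
\<close>

theorem value_decay_of_damped_trajectory:
  fixes f :: "'a::real_inner \<Rightarrow> real" and x x' x'' g :: "real \<Rightarrow> 'a" and z :: 'a
    and \<Theta> \<sigma> \<sigma>' \<sigma>'' :: "real \<Rightarrow> real"
  assumes convex: "convex_on UNIV f"
    and grad: "\<And>t. t \<ge> t0 \<Longrightarrow> GDERIV f (x t) :> g t"
    and x': "\<And>t. t \<ge> t0 \<Longrightarrow> (x has_vector_derivative x' t) (at t within {t0..})"
    and x'': "\<And>t. t \<ge> t0 \<Longrightarrow> (x' has_vector_derivative x'' t) (at t within {t0..})"
    and \<Theta>: "\<And>t. t \<ge> t0 \<Longrightarrow> (\<Theta> has_real_derivative \<sigma> t) (at t within {t0..})"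
    and \<sigma>': "\<And>t. t \<ge> t0 \<Longrightarrow> (\<sigma> has_real_derivative \<sigma>' t) (at t within {t0..})"
    and \<sigma>'': "\<And>t. t \<ge> t0 \<Longrightarrow> (\<sigma>' has_real_derivative \<sigma>'' t) (at t within {t0..})"
    and signs: "\<And>t. t \<ge> t0 \<Longrightarrow> \<sigma> t \<ge> 0" "\<And>t. t \<ge> t0 \<Longrightarrow> \<sigma>' t \<le> 0" "\<And>t. t \<ge> t0 \<Longrightarrow> \<sigma>'' t \<ge> 0"
    and k: "k \<ge> 0" and \<rho>: "\<rho> \<ge> 0"
    and ode: "\<And>t. t \<ge> t0 \<Longrightarrow>
      x'' t + ((k - \<rho>) * \<sigma> t) *\<^sub>R x' t + exp ((k + 2 * \<rho>) * \<Theta> t) *\<^sub>R g t = 0"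
  shows "\<exists>M. \<forall>t\<ge>t0. f (x t) - f z \<le> M * exp (- k * \<Theta> t)"
proof -
  define A where "A t = exp (k * \<Theta> t)" for t
  define C where "C t = exp (- 2 * \<rho> * \<Theta> t)" for t
  define W where "W t = f (x t) - f z" for t
  define y where "y t = x t - z" for t
  define p where "p t = (k * \<sigma> t) *\<^sub>R y t + x' t" for t
  define D where "D t = k * (\<rho> * (\<sigma> t)\<^sup>2 - \<sigma>' t)" for t
  define H where "H t = inner (p t) (p t) / 2 + D t * inner (y t) (y t) / 2" for t
  define E where "E t = A t * W t + C t * H t" for t
  define p' where "p' t = (k * \<sigma>' t) *\<^sub>R y t + (k * \<sigma> t) *\<^sub>R x' t
      - ((k - \<rho>) * \<sigma> t) *\<^sub>R x' t - exp ((k + 2 * \<rho>) * \<Theta> t) *\<^sub>R g t" for t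
  define D' where "D' t = k * (2 * \<rho> * \<sigma> t * \<sigma>' t - \<sigma>'' t)" for t
  define E' where "E' t = (k * \<sigma> t * A t) * W t + A t * inner (x' t) (g t)
    + ((- 2 * \<rho> * \<sigma> t * C t) * (inner (p t) (p t) / 2 + D t * inner (y t) (y t) / 2)
       + C t * (inner (p t) (p' t) + (D' t * inner (y t) (y t) / 2 + D t * inner (y t) (x' t))))"
    for t
  have E_deriv: "(E has_real_derivative E' t) (at t within {t0..})" if t: "t \<ge> t0" for t
  proof -
    note [derivative_intros] = x'[OF t] x''[OF t] \<Theta>[OF t] \<sigma>'[OF t] \<sigma>''[OF t]
    have dW: "(W has_real_derivative inner (x' t) (g t)) (at t within {t0..})"
      unfolding W_def
      by (auto intro!: derivative_eq_intros GDERIV_chain_within[OF grad[OF t] x'[OF t]])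
    have dA: "(A has_real_derivative k * \<sigma> t * A t) (at t within {t0..})"
      unfolding A_def by (auto intro!: derivative_eq_intros)
    have dC: "(C has_real_derivative - 2 * \<rho> * \<sigma> t * C t) (at t within {t0..})"
      unfolding C_def by (auto intro!: derivative_eq_intros)
    have dD: "(D has_real_derivative D' t) (at t within {t0..})"
      unfolding D_def D'_def
      by (auto intro!: derivative_eq_intros simp: algebra_simps)
    have dy: "(y has_vector_derivative x' t) (at t within {t0..})"
      unfolding y_def by (auto intro!: derivative_eq_intros)
    have "x'' t = - (((k - \<rho>) * \<sigma> t) *\<^sub>R x' t) - exp ((k + 2 * \<rho>) * \<Theta> t) *\<^sub>R g t"
      using ode[OF t] by (simp add: algebra_simps eq_neg_iff_add_eq_0)
    then have "p' t = (k * \<sigma> t) *\<^sub>R x' t + (k * \<sigma>' t) *\<^sub>R y t + x'' t"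
      by (simp add: p'_def)
    then have dp: "(p has_vector_derivative p' t) (at t within {t0..})"
      unfolding p_def
      by (auto intro!: derivative_eq_intros dy simp: has_real_derivative_iff_has_vector_derivative)
    have sq: "((\<lambda>t. inner (u t) (u t)) has_real_derivative 2 * inner (u t) u') (at t within {t0..})"
      if "(u has_vector_derivative u') (at t within {t0..})" for u :: "real \<Rightarrow> 'a" and u'
      using has_derivative_inner[OF that[unfolded has_vector_derivative_def]
          that[unfolded has_vector_derivative_def]]
      by (simp add: has_field_derivative_def inner_commute mult_commute_abs algebra_simps)
    have dH: "(H has_real_derivative inner (p t) (p' t)
        + (D' t * inner (y t) (y t) / 2 + D t * inner (y t) (x' t))) (at t within {t0..})"
      unfolding H_def
      by (rule DERIV_cong[OF DERIV_add[OF DERIV_cdivide[OF sq[OF dp]]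
              DERIV_cdivide[OF DERIV_mult[OF dD sq[OF dy]]]]]) (simp add: field_simps)
    show ?thesis
      unfolding E_def
      by (rule DERIV_cong[OF DERIV_add[OF DERIV_mult[OF dA dW] DERIV_mult[OF dC dH]]])
        (simp add: E'_def H_def algebra_simps)
  qed
  have E'_nonpos: "E' t \<le> 0" if t: "t \<ge> t0" for t
    unfolding E'_def p_def D_def D'_def p'_def
  proof (rule energy_derivative_nonpos)
    show "A t = C t * exp ((k + 2 * \<rho>) * \<Theta> t)"
      by (simp add: A_def C_def exp_add[symmetric] algebra_simps)
    show "W t \<le> inner (y t) (g t)"
      using convex_on_imp_above_tangent_plane[OF convex grad[OF t], of z]
      by (simp add: W_def y_def inner_diff_left)
  qed (use signs[OF t] k \<rho> in \<open>auto simp: A_def C_def\<close>)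
  have "W t \<le> E t0 * exp (- k * \<Theta> t)" if t: "t \<ge> t0" for t
  proof -
    have "D t \<ge> 0"
      unfolding D_def using signs[OF t] k \<rho>
      by (intro mult_nonneg_nonneg) (auto intro: order_trans[of _ 0])
    then have "C t * H t \<ge> 0" by (simp add: C_def H_def)
    then have "A t * W t \<le> E t0"
      using nonincreasing_of_derivative_nonpos_on_ray[of t0 E E', OF E_deriv E'_nonpos t]
      by (simp add: E_def)
    then show ?thesis
      by (simp add: A_def exp_minus field_simps)
  qed
  then show ?thesis unfolding W_def by blast
qed

section \<open>Power damping\<close>

theorem theorem11:
  fixes f :: "'a::{real_inner, complete_space} \<Rightarrow> real"
    and x :: "real \<Rightarrow> 'a"
    and \<alpha> \<mu> q t0 :: real
  assumes convex: "convex_on UNIV f"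
    and differentiable: "\<And>y. f differentiable (at y)"
    and argmin_nonempty: "{z. is_arg_min f (\<lambda>_. True) z} \<noteq> {}"
    and mu: "\<mu> \<ge> 0"
    and q: "0 \<le> q" "q \<le> 1"
    and alpha: "\<alpha> > 0"
    and t0: "t0 > 0"
    and trajectory: "solution_trajectory \<alpha> \<mu> q t0 f x"
    and alpha_le: "\<alpha> \<le> \<mu> * q"
  shows "(\<lambda>t. f (x t) - (INF y. f y))
           \<in> O[at_top](\<lambda>t. exp (- ((2 * \<alpha> + \<mu> * q) / 3) * t powr q))"
proof -
  obtain z where z: "\<And>y. f z \<le> f y"
    using argmin_nonempty by (auto simp: is_arg_min_def not_less)
  then have inf: "(INF y. f y) = f z" by (intro cInf_eq_minimum) auto
  have q_pos: "q > 0" using alpha alpha_le q by (cases "q = 0") auto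
  obtain x' x'' where x':
      "\<And>t. t \<ge> t0 \<Longrightarrow> (x has_vector_derivative x' t) (at t within {t0..})"
    and x'': "\<And>t. t \<ge> t0 \<Longrightarrow> (x' has_vector_derivative x'' t) (at t within {t0..})"
    and ode: "\<And>t. t \<ge> t0 \<Longrightarrow> x'' t + (\<alpha> / t powr (1 - q)) *\<^sub>R x' t
                + exp (\<mu> * t powr q) *\<^sub>R gradient f (x t) = 0"
    using trajectory unfolding solution_trajectory_def by blast
  define k where "k = (2 * \<alpha> + \<mu> * q) / 3"
  define \<rho> where "\<rho> = (\<mu> * q - \<alpha>) / 3"
  have k_nonneg: "k \<ge> 0" using alpha alpha_le by (simp add: k_def)
  have "\<exists>M. \<forall>t\<ge>t0. f (x t) - f z \<le> M * exp (- k * (t powr q / q))"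
  proof (rule value_decay_of_damped_trajectory[where
        \<Theta> = "\<lambda>t. t powr q / q" and \<sigma> = "\<lambda>t. t powr (q - 1)"
        and \<sigma>' = "\<lambda>t. (q - 1) * t powr (q - 2)"
        and \<sigma>'' = "\<lambda>t. (q - 1) * ((q - 2) * t powr (q - 3))"
        and g = "\<lambda>t. gradient f (x t)" and x' = x' and x'' = x'' and \<rho> = \<rho>])
    fix t assume t: "t \<ge> t0"
    then have t_pos: "t > 0" using t0 by simp
    show "GDERIV f (x t) :> gradient f (x t)" by (rule GDERIV_gradient) fact
    have powr_deriv: "((\<lambda>t. t powr r) has_real_derivative r * t powr (r - 1)) (at t within {t0..})"
      for r
      by (rule has_field_derivative_at_within[OF has_real_derivative_powr[OF t_pos]])
    show "((\<lambda>t. t powr q / q) has_real_derivative t powr (q - 1)) (at t within {t0..})"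
      using DERIV_cdivide[OF powr_deriv[of q], of q] q_pos by simp
    show "((\<lambda>t. t powr (q - 1)) has_real_derivative (q - 1) * t powr (q - 2)) (at t within {t0..})"
      using powr_deriv[of "q - 1"] by (simp add: diff_diff_eq)
    show "((\<lambda>t. (q - 1) * t powr (q - 2)) has_real_derivative
        (q - 1) * ((q - 2) * t powr (q - 3))) (at t within {t0..})"
      using DERIV_cmult[OF powr_deriv[of "q - 2"], of "q - 1"] by (simp add: diff_diff_eq)
    show "(q - 1) * t powr (q - 2) \<le> 0" using q by (simp add: mult_nonpos_nonneg)
    show "(q - 1) * ((q - 2) * t powr (q - 3)) \<ge> 0"
      using q by (intro mult_nonpos_nonpos) (auto simp: mult_nonpos_nonneg)
    have "(k - \<rho>) * t powr (q - 1) = \<alpha> / t powr (1 - q)"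
      using powr_minus_divide[of t "1 - q"] by (simp add: k_def \<rho>_def field_simps)
    moreover have "(k + 2 * \<rho>) * (t powr q / q) = \<mu> * t powr q"
      using q_pos by (simp add: k_def \<rho>_def field_simps)
    ultimately show "x'' t + ((k - \<rho>) * t powr (q - 1)) *\<^sub>R x' t
        + exp ((k + 2 * \<rho>) * (t powr q / q)) *\<^sub>R gradient f (x t) = 0"
      using ode[OF t] by simp
  qed (use x' x'' convex k_nonneg alpha_le in \<open>auto simp: \<rho>_def\<close>)
  then obtain M where M: "\<And>t. t \<ge> t0 \<Longrightarrow> f (x t) - f z \<le> M * exp (- k * (t powr q / q))"
    by blast
  have "norm (f (x t) - (INF y. f y)) \<le> \<bar>M\<bar> * norm (exp (- k * t powr q))" if t: "t \<ge> t0" for t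
  proof -
    \<comment> \<open>Since \<open>q \<le> 1\<close>, the rate \<open>k / q\<close> just obtained is at least \<open>k\<close>.\<close>
    have "t powr q * 1 \<le> t powr q * (1 / q)"
      using q_pos q by (intro mult_left_mono) auto
    then have "exp (- k * (t powr q / q)) \<le> exp (- k * t powr q)"
      using mult_left_mono[of "t powr q" "t powr q / q" k] k_nonneg by simp
    then have "M * exp (- k * (t powr q / q)) \<le> \<bar>M\<bar> * exp (- k * t powr q)"
      by (intro mult_mono) auto
    then show ?thesis using M[OF t] z[of "x t"] by (simp add: inf)
  qed
  then have "(\<lambda>t. f (x t) - (INF y. f y)) \<in> O[at_top](\<lambda>t. exp (- k * t powr q))"
    by (intro bigoI[of _ "\<bar>M\<bar>"] eventually_mono[OF eventually_ge_at_top[of t0]])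
  then show ?thesis by (simp add: k_def)
qed

end
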